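(* Let $X\subset\mathbb{R}^n$ be a compact convex set and let $f=(f_1,\dots,f_m):\mathbb{R}\times X\to\mathbb{R}^m$ and $f_0:\mathbb{R}\times X\to\mathbb{R}$ be such that, for every $T>0$, $t\mapsto f(t,x)$ and $t\mapsto f_0(t,x)$ are integrable on $[0,T]$ for each $x\in X$, and $f_i(t,\cdot)$ ($i=0,1,\dots,m$) is convex on $X$ for each $t$. Suppose the environment is viable: there exists $x^\dagger\in X$ with $f(t,x^\dagger)\le0$ for all $t\ge0$. For $T>0$ let $x^*$ be a solution of the offline problem $$x^*\in\operatorname{argmin}_{x\in X}\int_0^T f_0(t,x)\,dt\quad\text{subject to } f(t,x)\le0\ \text{ for all } t\in[0,T],$$ and suppose there is a finite constant $K$, independent of $T$, such that $K\ge f_0(t,x^* )-\min_{x\in X}f_0(t,x)$ for all $t\in[0,T]$. Let $\delta>0$ and $\bar f_\delta(t,x)=\max\{f(t,x),-\delta\}$ (componentwise). Let $x(0)\in X$ and $\lambda(0)\in\Lambda=\mathbb{R}^m_+$ be given, and for a gain $\varepsilon>1$ let $(x(t),\lambda(t))\in X\times\Lambda$, $t\ge0$, be a solution with these initial conditions of the saddle point controller for the environment $\bar f_\delta$, $$\dot x=\Pi_X\big(x,-\varepsilon(f_{0,x}(t,x)+\bar f_{\delta,x}(t,x)\lambda)\big),\qquad \dot\lambda=\Pi_\Lambda\big(\lambda,\varepsilon \bar f_\delta(t,x)\big).$$ Then the regret $\mathcal{R}_T=\int_0^T f_0(t,x(t))\,dt-\int_0^T f_0(t,x^* )\,dt$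 satisfies $\mathcal{R}_T\le\frac1\varepsilon V_{x^*,0}(x(0),\lambda(0))$ for all $T>0$, where $V_{\bar x,\bar\lambda}(x,\lambda)=\frac12\big(\|x-\bar x\|^2+\|\lambda-\bar\lambda\|^2\big)$, and the $\delta$-saturated fit $\bar{\mathcal{F}}_{T}=\int_0^T\bar f_{\delta}(t,x(t))\,dt$ satisfies $$\bar{\mathcal{F}}_{T,i}\le\mathcal{O}\big(\sqrt{KT},\varepsilon^0\big),\qquad i=1,\dots,m,$$ that is, there is a constant $C$ depending neither on $T$ nor on $\varepsilon$ (but possibly on $X$, $f$, $f_0$, $\delta$, $x(0)$, $\lambda(0)$) such that $\bar{\mathcal{F}}_{T,i}\le C(1+\sqrt{KT})$ for all $T>0$, all $\varepsilon>1$ and all $i=1,\dots,m$.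
   Context: Projection: for a closed convex set $Y\subseteq\mathbb{R}^k$, $P_Y(z)=\operatorname{argmin}_{y\in Y}\|y-z\|$ (Euclidean norm), and for $y\in Y$, $v\in\mathbb{R}^k$, $\Pi_Y(y,v)=\lim_{\delta'\to0^+}\big(P_Y(y+\delta' v)-y\big)/\delta'$. Subgradients: for a convex $g:X\to\mathbb{R}$, a subgradient $g_x(x)$ at $x\in X$ is a vector with $g(y)\ge g(x)+g_x(x)^T(y-x)$ for all $y\in X$. Subgradients of $f_0(t,\cdot)$ and of the components of $f(t,\cdot)$ and $\bar f_\delta(t,\cdot)$ are assumed to exist at all points of $X$; $f_{0,x}(t,x)$ is a fixed choice of subgradient of $f_0(t,\cdot)$ at $x$, and $\bar f_{\delta,x}(t,x)\in\mathbb{R}^{n\times m}$ is the matrix whose columns are fixed choices of subgradients of the components of $\bar f_\delta(t,\cdot)$ at $x$. Inequalities between vectors are componentwise. A solution of the differential equations is a pair of functions absolutely continuous on bounded time intervals satisfying the equations for almost every $t$. The offline optimal actions $x^*$ are assumed to exist (they may depend on $T$), and the integrals defining saturated fit and regret along the trajectory are assumed to be well defined. *)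

theory Defs
  imports "HOL-Analysis.Analysis"
begin

text \<open>The library's \<^const>\<open>closest_point\<close> is the Euclidean projection. For closed convex \<open>Y\<close> and
  \<open>y \<in> Y\<close> the limit exists; otherwise the value is unspecified.\<close>

definition projected_field ::
    "'a::euclidean_space set \<Rightarrow> 'a \<Rightarrow> 'a \<Rightarrow> 'a" where
  "projected_field Y y v =
     Lim (at_right (0::real)) (\<lambda>h. (closest_point Y (y + h *\<^sub>R v) - y) /\<^sub>R h)"

definition is_subgradient ::
    "'a::euclidean_space set \<Rightarrow> ('a \<Rightarrow> real) \<Rightarrow> 'a \<Rightarrow> 'a \<Rightarrow> bool" where
  "is_subgradient X g x v \<longleftrightarrow> (\<forall>y\<in>X. g y \<ge> g x + v \<bullet> (y - x))"

definition subdifferentiable_on ::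
    "'a::euclidean_space set \<Rightarrow> ('a \<Rightarrow> real) \<Rightarrow> bool" where
  "subdifferentiable_on X g \<longleftrightarrow> (\<forall>x\<in>X. \<exists>v. is_subgradient X g x v)"

text \<open>The finite families of non-overlapping subintervals of \<open>{a..b}\<close> are the library's divisions;
  their members are nonempty compact intervals \<open>{Inf k..Sup k}\<close> (degenerate ones contribute 0).\<close>

definition abs_cont_on ::
    "real \<Rightarrow> real \<Rightarrow> (real \<Rightarrow> 'a::real_normed_vector) \<Rightarrow> bool" where
  "abs_cont_on a b u \<longleftrightarrow>
     (\<forall>e>0. \<exists>d>0. \<forall>D S. D division_of S \<longrightarrow> S \<subseteq> {a..b} \<longrightarrow> (\<Sum>k\<in>D. Sup k - Inf k) < d \<longrightarrow>
        (\<Sum>k\<in>D. norm (u (Sup k) - u (Inf k))) < e)"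

definition saturate ::
    "real \<Rightarrow> (real \<Rightarrow> 'a \<Rightarrow> real^'m) \<Rightarrow> real \<Rightarrow> 'a \<Rightarrow> real^'m" where
  "saturate \<delta> f t x = (\<chi> i. max (f t x $ i) (- \<delta>))"

definition nonneg_orthant :: "(real^'m) set" where
  "nonneg_orthant = {l. 0 \<le> l}"

text \<open>The environment is \<open>g\<close>, with constraint subgradients as the columns of the matrix \<open>gx t x\<close>;
  \<open>f0x\<close> is the objective subgradient. Values of \<open>x\<close> and \<open>l\<close> at negative times are irrelevant.\<close>

definition saddle_point_trajectory ::
    "(real^'n) set \<Rightarrow> (real \<Rightarrow> real^'n \<Rightarrow> real^'n) \<Rightarrow> (real \<Rightarrow> real^'n \<Rightarrow> real^'m) \<Rightarrow>
     (real \<Rightarrow> real^'n \<Rightarrow> real^'m^'n) \<Rightarrow> real \<Rightarrow> (real \<Rightarrow> real^'n) \<Rightarrow> (real \<Rightarrow> real^'m) \<Rightarrow> bool" where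
  "saddle_point_trajectory X f0x g gx \<epsilon> x l \<longleftrightarrow>
     (\<forall>t\<ge>0. x t \<in> X \<and> l t \<in> nonneg_orthant) \<and>
     (\<forall>T>0. abs_cont_on 0 T x \<and> abs_cont_on 0 T l) \<and>
     (AE t in lebesgue. t > 0 \<longrightarrow>
        (x has_vector_derivative
           projected_field X (x t) (- (\<epsilon> *\<^sub>R (f0x t (x t) + gx t (x t) *v l t)))) (at t) \<and>
        (l has_vector_derivative
           projected_field nonneg_orthant (l t) (\<epsilon> *\<^sub>R g t (x t))) (at t))"

definition offline_optimal ::
    "(real^'n) set \<Rightarrow> (real \<Rightarrow> real^'n \<Rightarrow> real^'m) \<Rightarrow> (real \<Rightarrow> real^'n \<Rightarrow> real) \<Rightarrow>
     real \<Rightarrow> real^'n \<Rightarrow> bool" where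
  "offline_optimal X f f0 T xs \<longleftrightarrow>
     is_arg_min (\<lambda>x. integral {0..T} (\<lambda>t. f0 t x)) (\<lambda>x. x \<in> X \<and> (\<forall>t\<in>{0..T}. f t x \<le> 0)) xs"

definition regret ::
    "(real \<Rightarrow> 'a \<Rightarrow> real) \<Rightarrow> real \<Rightarrow> (real \<Rightarrow> 'a) \<Rightarrow> 'a \<Rightarrow> real" where
  "regret f0 T x xs = integral {0..T} (\<lambda>t. f0 t (x t)) - integral {0..T} (\<lambda>t. f0 t xs)"

definition saturated_fit ::
    "real \<Rightarrow> (real \<Rightarrow> 'a \<Rightarrow> real^'m) \<Rightarrow> real \<Rightarrow> (real \<Rightarrow> 'a) \<Rightarrow> real^'m" where
  "saturated_fit \<delta> f T x = integral {0..T} (\<lambda>t. saturate \<delta> f t (x t))"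

definition energy :: "real^'n \<Rightarrow> real^'m \<Rightarrow> real^'n \<Rightarrow> real^'m \<Rightarrow> real" where
  "energy xb lb x l = 1/2 * ((norm (x - xb))\<^sup>2 + (norm (l - lb))\<^sup>2)"

end

theory Submission
  imports Defs
begin

text \<open>The energy with respect to a fixed saddle-point candidate \<open>(xb, lb)\<close> decreases along the
  trajectory at least as fast as \<open>\<epsilon>\<close> times the Lagrangian gap, because projecting a velocity onto the
  tangent cone does not increase its component pointing away from any feasible point. Integrating
  with \<open>lb = 0\<close> bounds the regret; integrating with \<open>lb\<close> equal to the positive part of the \<open>i\<close>-th fit in
  coordinate \<open>i\<close> gives a quadratic inequality for this fit, since the regret is at least \<open>- K * T\<close>.\<close>

section \<open>Projected velocities\<close>

text \<open>The difference quotients inherit the obtuse-angle inequality of the projection, and it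
  survives in the limit. Existence of the limit has to be shown first, since \<open>Lim\<close> is
  unspecified without it; it comes from the Cauchy property of the quotients.\<close>

lemma projected_field_inner_le:
  fixes Y :: "'a::euclidean_space set"
  assumes Y: "convex Y" "closed Y" and y: "y \<in> Y" and z: "z \<in> Y"
  shows "(y - z) \<bullet> projected_field Y y v \<le> (y - z) \<bullet> v"
proof -
  define q where "q h = (closest_point Y (y + h *\<^sub>R v) - y) /\<^sub>R h" for h :: real
  have P_in: "closest_point Y a \<in> Y" for a
    using Y y closest_point_in_set by blast
  have P_eq: "closest_point Y (y + h *\<^sub>R v) = y + h *\<^sub>R q h" if "h > 0" for h
    using that by (simp add: q_def)
  \<comment> \<open>Obtuse-angle criterion for the projection \<open>y + h *\<^sub>R q h\<close> of
    \<open>y + h *\<^sub>R v\<close>, divided by \<open>h\<close>.\<close>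
  have var: "(v - q h) \<bullet> (w - y - h *\<^sub>R q h) \<le> 0" if "h > 0" "w \<in> Y" for h w
  proof -
    have "(y + h *\<^sub>R v - (y + h *\<^sub>R q h)) \<bullet> (w - (y + h *\<^sub>R q h)) \<le> 0"
      using closest_point_dot[OF Y \<open>w \<in> Y\<close>, of "y + h *\<^sub>R v"] P_eq[OF \<open>h > 0\<close>] by simp
    moreover have "(y + h *\<^sub>R v - (y + h *\<^sub>R q h)) \<bullet> (w - (y + h *\<^sub>R q h))
        = h * ((v - q h) \<bullet> (w - y - h *\<^sub>R q h))"
      by (simp add: algebra_simps inner_simps)
    ultimately show ?thesis
      using \<open>h > 0\<close> by (simp add: mult_le_0_iff)
  qed
  \<comment> \<open>\<open>q h\<close> is the projection of \<open>v\<close> onto \<open>(Y - y) / h\<close>, and these sets grow as \<open>h\<close> decreases.\<close>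
  have mono: "(norm (v - q h'))\<^sup>2 + (norm (q h - q h'))\<^sup>2 \<le> (norm (v - q h))\<^sup>2"
    if "0 < h'" "h' \<le> h" for h h'
  proof -
    have h: "h > 0" using that by simp
    \<comment> \<open>The point \<open>y + h' *\<^sub>R q h\<close> lies on the segment from
      \<open>y\<close> to the projection for \<open>h\<close>, so it is a legitimate competitor in
      \<open>var\<close> for the smaller step \<open>h'\<close>.\<close>
    have "(1 - h'/h) *\<^sub>R y + (h'/h) *\<^sub>R closest_point Y (y + h *\<^sub>R v) \<in> Y"
      using that h by (intro convexD[OF Y(1)] y P_in) auto
    also have "(1 - h'/h) *\<^sub>R y + (h'/h) *\<^sub>R closest_point Y (y + h *\<^sub>R v) = y + h' *\<^sub>R q h"
      using h by (simp add: P_eq algebra_simps)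
    finally have "(v - q h') \<bullet> (h' *\<^sub>R (q h - q h')) \<le> 0"
      using var[OF \<open>0 < h'\<close>, of "y + h' *\<^sub>R q h"] by (simp add: algebra_simps)
    then have "(v - q h') \<bullet> (q h - q h') \<le> 0"
      using \<open>0 < h'\<close> by (simp add: mult_le_0_iff)
    then show ?thesis
      unfolding power2_norm_eq_inner by (simp add: inner_simps inner_commute algebra_simps)
  qed
  \<comment> \<open>As \<open>h\<close> shrinks, the squared distance from \<open>v\<close> to
    \<open>q h\<close> decreases and stays above 0. Once it is within \<open>(e/2)\<^sup>2\<close>
    of its infimum, \<open>mono\<close> leaves \<open>q\<close> less than \<open>e/2\<close> of room
    to move.\<close>
  have "cauchy_filter (filtermap q (at_right 0))"
    unfolding cauchy_filter_metric_filtermap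
  proof (intro allI impI)
    fix e :: real assume "e > 0"
    define D where "D = (\<lambda>h. (norm (v - q h))\<^sup>2) ` {0<..}"
    have bdd: "bdd_below D" unfolding D_def by (intro bdd_belowI[of _ 0]) auto
    have "D \<noteq> {}" "Inf D < Inf D + (e/2)\<^sup>2" using \<open>e > 0\<close> by (auto simp: D_def)
    from cInf_lessD[OF this] obtain h0 where h0: "h0 > 0" "(norm (v - q h0))\<^sup>2 < Inf D + (e/2)\<^sup>2"
      unfolding D_def by auto
    have near: "dist (q h) (q h0) < e/2" if "0 < h" "h \<le> h0" for h
    proof -
      have "Inf D \<le> (norm (v - q h))\<^sup>2"
        using that by (intro cInf_lower[OF _ bdd]) (auto simp: D_def)
      with mono[OF that] h0(2) have "(norm (q h0 - q h))\<^sup>2 < (e/2)\<^sup>2" by linarith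
      then have "norm (q h0 - q h) < e/2"
        by (rule power_less_imp_less_base) (use \<open>e > 0\<close> in simp)
      then show ?thesis
        by (simp add: dist_norm norm_minus_commute)
    qed
    have "eventually (\<lambda>h. 0 < h \<and> h \<le> h0) (at_right 0)"
      using h0(1) by (auto simp: eventually_at_right_field intro!: exI[of _ h0])
    moreover have "dist (q h) (q k) < e"
      if "(0 < h \<and> h \<le> h0) \<and> (0 < k \<and> k \<le> h0)" for h k
      using that near[of h] near[of k] dist_triangle_half_l[of "q h" "q h0" e "q k"]
      by (simp add: dist_commute)
    ultimately show "\<exists>P. eventually P (at_right 0) \<and> (\<forall>h k. P h \<and> P k \<longrightarrow> dist (q h) (q k) < e)"
      by blast
  qed
  then obtain L where L: "(q \<longlongrightarrow> L) (at_right 0)"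
    unfolding filterlim_def using cauchy_filter_convergent convergent_filter_iff by blast
  have eq: "projected_field Y y v = L"
    unfolding projected_field_def q_def[symmetric] using L by (intro tendsto_Lim) simp_all
  \<comment> \<open>The convergent \<open>q h\<close> is multiplied by a step tending to 0, so
    \<open>var\<close> with competitor \<open>z\<close> becomes an inequality about \<open>L\<close>
    alone.\<close>
  have "((\<lambda>h. (v - q h) \<bullet> (z - y - h *\<^sub>R q h)) \<longlongrightarrow> (v - L) \<bullet> (z - y - 0 *\<^sub>R L)) (at_right 0)"
    by (intro tendsto_intros L)
  moreover have "eventually (\<lambda>h. (v - q h) \<bullet> (z - y - h *\<^sub>R q h) \<le> 0) (at_right 0)"
    using var z by (auto simp: eventually_at_right_field intro!: exI[of _ 1])
  ultimately have "(v - L) \<bullet> (z - y - 0 *\<^sub>R L) \<le> 0"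
    by (rule tendsto_upperbound) simp
  then show ?thesis
    unfolding eq by (simp add: inner_simps inner_commute algebra_simps)
qed

section \<open>Absolutely continuous functions and integration of bounds on their
  derivatives\<close>

lemma division_real_memberD:
  fixes D :: "real set set"
  assumes "D division_of S" "S \<subseteq> {a..b}" "k \<in> D"
  shows "Inf k \<in> {a..b}" "Sup k \<in> {a..b}"
proof -
  obtain c d where k: "k = {c..d}"
    using division_ofD(4)[OF assms(1,3)] by (auto simp: box_real)
  have "k \<noteq> {}" "k \<subseteq> {a..b}"
    using division_ofD(2,3)[OF assms(1,3)] assms(2) by auto
  then show "Inf k \<in> {a..b}" "Sup k \<in> {a..b}"
    unfolding k by auto
qed

lemma abs_cont_onE:
  assumes "abs_cont_on a b u" "e > 0"
  obtains d where "d > 0"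
    "\<And>D S. D division_of S \<Longrightarrow> S \<subseteq> {a..b} \<Longrightarrow> (\<Sum>k\<in>D. Sup k - Inf k) < d \<Longrightarrow>
        (\<Sum>k\<in>D. norm (u (Sup k) - u (Inf k))) < e"
  using assms unfolding abs_cont_on_def by blast

lemma abs_cont_on_imp_continuous_on:
  fixes u :: "real \<Rightarrow> 'a::real_normed_vector"
  assumes "abs_cont_on a b u"
  shows "continuous_on {a..b} u"
  unfolding continuous_on_iff
proof (intro ballI allI impI)
  fix s e :: real assume s: "s \<in> {a..b}" and "e > 0"
  obtain d where "d > 0" and
    d: "\<And>D S. D division_of S \<Longrightarrow> S \<subseteq> {a..b} \<Longrightarrow> (\<Sum>k\<in>D. Sup k - Inf k) < d \<Longrightarrow>
        (\<Sum>k\<in>D. norm (u (Sup k) - u (Inf k))) < e"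
    by (rule abs_cont_onE[OF assms \<open>e > 0\<close>]) blast
  have "dist (u t) (u s) < e" if "t \<in> {a..b}" "dist t s < d" for t
  proof -
    \<comment> \<open>One interval already forms a division; \<open>min\<close> and
      \<open>max\<close> treat both orders of the two points, and their coincidence, at
      once.\<close>
    have "{{min s t..max s t}} division_of {min s t..max s t}"
      using division_of_self[of "min s t" "max s t"] by (simp add: box_real)
    moreover have "{min s t..max s t} \<subseteq> {a..b}" using s that by auto
    moreover have "(\<Sum>k\<in>{{min s t..max s t}}. Sup k - Inf k) < d"
      using that(2) by (auto simp: dist_real_def max_def min_def)
    ultimately have "(\<Sum>k\<in>{{min s t..max s t}}. norm (u (Sup k) - u (Inf k))) < e" by (rule d)
    then show ?thesis
      by (auto simp: dist_norm max_def min_def norm_minus_commute split: if_splits)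
  qed
  with \<open>d > 0\<close> show "\<exists>d>0. \<forall>t\<in>{a..b}. dist t s < d \<longrightarrow> dist (u t) (u s) < e" by blast
qed

text \<open>Comparing increments of \<open>w\<close> and \<open>u\<close> directly also covers
  compositions that are Lipschitz only on the range of \<open>u\<close>.\<close>

lemma abs_cont_on_lipschitz_compose:
  fixes u :: "real \<Rightarrow> 'a::real_normed_vector" and w :: "real \<Rightarrow> 'b::real_normed_vector"
  assumes u: "abs_cont_on a b u"
    and M: "\<And>s t. s \<in> {a..b} \<Longrightarrow> t \<in> {a..b} \<Longrightarrow> norm (w s - w t) \<le> M * norm (u s - u t)"
  shows "abs_cont_on a b w"
  unfolding abs_cont_on_def
proof (intro allI impI)
  fix e :: real assume "e > 0"
  \<comment> \<open>\<open>M\<close> may be zero or negative, so the tolerance is divided by this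
    positive bound instead.\<close>
  define B where "B = \<bar>M\<bar> + 1"
  have "e / B > 0" and "B > 0" using \<open>e > 0\<close> by (auto simp: B_def)
  obtain d where "d > 0" and
    d: "\<And>D S. D division_of S \<Longrightarrow> S \<subseteq> {a..b} \<Longrightarrow> (\<Sum>k\<in>D. Sup k - Inf k) < d \<Longrightarrow>
        (\<Sum>k\<in>D. norm (u (Sup k) - u (Inf k))) < e / B"
    by (rule abs_cont_onE[OF u \<open>e / B > 0\<close>]) blast
  have "(\<Sum>k\<in>D. norm (w (Sup k) - w (Inf k))) < e"
    if D: "D division_of S" "S \<subseteq> {a..b}" "(\<Sum>k\<in>D. Sup k - Inf k) < d" for D S
  proof -
    have "(\<Sum>k\<in>D. norm (w (Sup k) - w (Inf k))) \<le> (\<Sum>k\<in>D. B * norm (u (Sup k) - u (Inf k)))"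
    proof (rule sum_mono)
      fix k assume "k \<in> D"
      note k = division_real_memberD[OF D(1,2) this]
      have "norm (w (Sup k) - w (Inf k)) \<le> M * norm (u (Sup k) - u (Inf k))"
        using k by (intro M)
      also have "\<dots> \<le> B * norm (u (Sup k) - u (Inf k))"
        by (intro mult_right_mono) (auto simp: B_def)
      finally show "norm (w (Sup k) - w (Inf k)) \<le> B * norm (u (Sup k) - u (Inf k))" .
    qed
    also have "\<dots> = B * (\<Sum>k\<in>D. norm (u (Sup k) - u (Inf k)))"
      by (simp add: sum_distrib_left)
    also have "\<dots> < e"
      using d[OF D] \<open>B > 0\<close> by (simp add: field_simps)
    finally show ?thesis .
  qed
  with \<open>d > 0\<close> show "\<exists>d>0. \<forall>D S. D division_of S \<longrightarrow> S \<subseteq> {a..b} \<longrightarrow> (\<Sum>k\<in>D. Sup k - Inf k) < d \<longrightarrow>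
        (\<Sum>k\<in>D. norm (w (Sup k) - w (Inf k))) < e"
    by blast
qed

lemma abs_cont_on_add:
  fixes u v :: "real \<Rightarrow> 'a::real_normed_vector"
  assumes u: "abs_cont_on a b u" and v: "abs_cont_on a b v"
  shows "abs_cont_on a b (\<lambda>t. u t + v t)"
  unfolding abs_cont_on_def
proof (intro allI impI)
  fix e :: real assume "e > 0"
  then have "e / 2 > 0" by simp
  obtain d where "d > 0" and
    d: "\<And>D S. D division_of S \<Longrightarrow> S \<subseteq> {a..b} \<Longrightarrow> (\<Sum>k\<in>D. Sup k - Inf k) < d \<Longrightarrow>
        (\<Sum>k\<in>D. norm (u (Sup k) - u (Inf k))) < e / 2"
    by (rule abs_cont_onE[OF u \<open>e / 2 > 0\<close>]) blast
  obtain d' where "d' > 0" and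
    d': "\<And>D S. D division_of S \<Longrightarrow> S \<subseteq> {a..b} \<Longrightarrow> (\<Sum>k\<in>D. Sup k - Inf k) < d' \<Longrightarrow>
        (\<Sum>k\<in>D. norm (v (Sup k) - v (Inf k))) < e / 2"
    by (rule abs_cont_onE[OF v \<open>e / 2 > 0\<close>]) blast
  have "(\<Sum>k\<in>D. norm (u (Sup k) + v (Sup k) - (u (Inf k) + v (Inf k)))) < e"
    if D: "D division_of S" "S \<subseteq> {a..b}" "(\<Sum>k\<in>D. Sup k - Inf k) < min d d'" for D S
  proof -
    have "(\<Sum>k\<in>D. norm (u (Sup k) + v (Sup k) - (u (Inf k) + v (Inf k))))
        \<le> (\<Sum>k\<in>D. norm (u (Sup k) - u (Inf k)) + norm (v (Sup k) - v (Inf k)))"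
      by (intro sum_mono norm_diff_triangle_ineq)
    also have "\<dots> < e"
      using d[OF D(1,2)] d'[OF D(1,2)] D(3) by (simp add: sum.distrib)
    finally show ?thesis .
  qed
  moreover have "min d d' > 0" using \<open>d > 0\<close> \<open>d' > 0\<close> by simp
  ultimately show "\<exists>d>0. \<forall>D S. D division_of S \<longrightarrow> S \<subseteq> {a..b} \<longrightarrow> (\<Sum>k\<in>D. Sup k - Inf k) < d \<longrightarrow>
        (\<Sum>k\<in>D. norm (u (Sup k) + v (Sup k) - (u (Inf k) + v (Inf k)))) < e"
    by blast
qed

text \<open>The squared norm is Lipschitz only on bounded sets; this suffices because
  \<open>u\<close> is continuous on a compact interval and so has bounded range.\<close>

lemma abs_cont_on_half_norm_squared:
  fixes u :: "real \<Rightarrow> 'a::real_normed_vector"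
  assumes u: "abs_cont_on a b u"
  shows "abs_cont_on a b (\<lambda>t. (norm (u t - c))\<^sup>2 / 2)"
proof -
  have "bounded (u ` {a..b})"
    by (intro compact_imp_bounded compact_continuous_image abs_cont_on_imp_continuous_on u) auto
  then obtain B where B: "\<And>t. t \<in> {a..b} \<Longrightarrow> norm (u t) \<le> B"
    unfolding bounded_iff by blast
  show ?thesis
  proof (rule abs_cont_on_lipschitz_compose[OF u])
    fix s t assume st: "s \<in> {a..b}" "t \<in> {a..b}"
    let ?p = "norm (u s - c)" and ?q = "norm (u t - c)"
    have "norm (?p\<^sup>2 / 2 - ?q\<^sup>2 / 2) = (?p + ?q) / 2 * \<bar>?p - ?q\<bar>"
    proof -
      have "?p\<^sup>2 / 2 - ?q\<^sup>2 / 2 = (?p + ?q) / 2 * (?p - ?q)"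
        by (simp add: power2_eq_square algebra_simps)
      then show ?thesis by (simp only: real_norm_def abs_mult) simp
    qed
    also have "\<dots> \<le> (B + norm c) * norm (u s - u t)"
    proof (rule mult_mono)
      show "(?p + ?q) / 2 \<le> B + norm c"
      proof -
        have "?p \<le> B + norm c" "?q \<le> B + norm c"
          using B[OF st(1)] B[OF st(2)] norm_triangle_ineq4[of "u s" c] norm_triangle_ineq4[of "u t" c]
          by simp_all
        then show ?thesis by simp
      qed
      show "\<bar>?p - ?q\<bar> \<le> norm (u s - u t)"
        using norm_triangle_ineq3[of "u s - c" "u t - c"] by simp
      show "0 \<le> B + norm c"
        using B[OF st(1)] norm_ge_zero[of "u s"] norm_ge_zero[of c] by linarith
    qed simp
    finally show "norm (?p\<^sup>2 / 2 - ?q\<^sup>2 / 2) \<le> (B + norm c) * norm (u s - u t)" .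
  qed
qed

text \<open>The Henstock sums of \<open>g\<close> control the increments over intervals tagged outside \<open>N\<close>; those tagged
  in \<open>N\<close> are kept inside an open set of small measure, where absolute continuity applies.\<close>

lemma abs_cont_on_increment_le_integral:
  fixes u u' g :: "real \<Rightarrow> real"
  assumes u: "abs_cont_on a b u" and "a \<le> b" and N: "negligible N"
    and deriv: "\<And>t. t \<in> {a..b} - N \<Longrightarrow> (u has_real_derivative u' t) (at t)"
    and le: "\<And>t. t \<in> {a..b} - N \<Longrightarrow> u' t \<le> g t"
    and g: "(g has_integral I) {a..b}"
  shows "u b - u a \<le> I"
proof (rule field_le_epsilon)
  fix e :: real assume "e > 0"
  \<comment> \<open>The linearization error is at most \<open>c\<close> times the interval length
    and thus sums to at most \<open>e / 3\<close>; the \<open>+ 1\<close> keeps the denominator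
    positive when \<open>a = b\<close>.\<close>
  define c where "c = e / (3 * (b - a + 1))"
  have "c > 0" using \<open>e > 0\<close> \<open>a \<le> b\<close> by (simp add: c_def)
  have c_le: "c * (b - a) \<le> e / 3"
    using \<open>e > 0\<close> \<open>a \<le> b\<close> by (simp add: c_def field_simps)
  \<comment> \<open>Changing \<open>g\<close> on a null set keeps the integral, and with
    \<open>g0\<close> the tags in \<open>N\<close> contribute nothing to the Henstock sum.\<close>
  define g0 where "g0 t = (if t \<in> N then 0 else g t)" for t
  have "(g0 has_integral I) {a..b}"
    using N _ g by (rule has_integral_spike) (simp add: g0_def)
  moreover have "e / 3 > 0" using \<open>e > 0\<close> by simp
  ultimately obtain \<gamma>0 where \<gamma>0: "gauge \<gamma>0" and
    sum_g0: "\<And>p. p tagged_division_of {a..b} \<Longrightarrow> \<gamma>0 fine p \<Longrightarrow>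
        norm ((\<Sum>(t, K)\<in>p. measure lborel K *\<^sub>R g0 t) - I) < e / 3"
    unfolding has_integral_real by metis
  obtain d where "d > 0" and
    d: "\<And>D S. D division_of S \<Longrightarrow> S \<subseteq> {a..b} \<Longrightarrow> (\<Sum>k\<in>D. Sup k - Inf k) < d \<Longrightarrow>
        (\<Sum>k\<in>D. norm (u (Sup k) - u (Inf k))) < e / 3"
    by (rule abs_cont_onE[OF u \<open>e / 3 > 0\<close>]) blast
  have N_null: "N \<in> null_sets lebesgue" using N by (simp add: negligible_iff_null_sets)
  \<comment> \<open>Outer regularity: as \<open>N\<close> is null, \<open>U\<close> itself has
    measure below \<open>d\<close>, the threshold supplied by absolute continuity.\<close>
  obtain U where U: "open U" "N \<subseteq> U" "U - N \<in> lmeasurable" "emeasure lebesgue (U - N) < ennreal d"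
    using sets_lebesgue_outer_open[of N d] N_null \<open>d > 0\<close> by blast
  have U_eq: "emeasure lebesgue U = emeasure lebesgue (U - N)"
    using emeasure_Diff_null_set[OF N_null, of U] U(1) by (simp add: borel_open)
  have U_meas: "U \<in> lmeasurable"
    using U(1,3) unfolding fmeasurable_def by (simp add: U_eq[symmetric] borel_open)
  have U_small: "measure lebesgue U < d"
    using U(4) \<open>d > 0\<close> unfolding U_eq[symmetric] emeasure_eq_measure2[OF U_meas]
    by (simp add: ennreal_less_iff)
  \<comment> \<open>The radius depends on the kind of tag: in \<open>N\<close> the ball must stay
    inside \<open>U\<close>, elsewhere in the interval \<open>u\<close> must be linear up to slope
    error \<open>c\<close>.\<close>
  have "\<exists>r>0. (t \<in> N \<longrightarrow> ball t r \<subseteq> U) \<and>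
      (t \<in> {a..b} - N \<longrightarrow> (\<forall>s. \<bar>s - t\<bar> < r \<longrightarrow> \<bar>u s - u t - u' t * (s - t)\<bar> \<le> c * \<bar>s - t\<bar>))" for t
  proof (cases "t \<in> N")
    case True
    with U show ?thesis by (meson DiffD2 open_contains_ball_eq subsetD)
  next
    case False
    show ?thesis
    proof (cases "t \<in> {a..b}")
      case True
      with False deriv have "(u has_real_derivative u' t) (at t)" by simp
      then have "(u has_derivative (*) (u' t)) (at t)"
        by (simp add: has_field_derivative_def)
      with \<open>c > 0\<close> obtain r where "r > 0"
        "\<And>s. norm (s - t) < r \<Longrightarrow> norm (u s - u t - u' t * (s - t)) \<le> c * norm (s - t)"
        unfolding has_derivative_at_alt by blast
      with False show ?thesis by auto
    qed (use False zero_less_one in blast)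
  qed
  then obtain r where r: "\<And>t. r t > 0" "\<And>t. t \<in> N \<Longrightarrow> ball t (r t) \<subseteq> U"
    "\<And>t s. t \<in> {a..b} - N \<Longrightarrow> \<bar>s - t\<bar> < r t \<Longrightarrow> \<bar>u s - u t - u' t * (s - t)\<bar> \<le> c * \<bar>s - t\<bar>"
    by metis
  define \<gamma> where "\<gamma> t = \<gamma>0 t \<inter> ball t (r t)" for t
  have "gauge \<gamma>"
    unfolding \<gamma>_def using \<gamma>0 r(1) by (intro gauge_Int gauge_ball_dependent) auto
  then obtain p where p: "p tagged_division_of {a..b}" "\<gamma> fine p"
    using fine_division_exists_real by blast
  have p\<gamma>0: "\<gamma>0 fine p" and pball: "(\<lambda>t. ball t (r t)) fine p"
    using p(2) unfolding \<gamma>_def by (auto simp: fine_Int)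
  have fin: "finite p" using p(1) by blast
  have mem: "\<exists>v w. K = {v..w} \<and> v \<le> w \<and> t \<in> {v..w} \<and> t \<in> {a..b} \<and> {v..w} \<subseteq> ball t (r t)"
    if tK: "(t, K) \<in> p" for t K
  proof -
    obtain v w where K: "K = {v..w}" using tagged_division_ofD(4)[OF p(1) tK] by (auto simp: box_real)
    moreover have "t \<in> K" "K \<subseteq> {a..b}" using tagged_division_ofD(2,3)[OF p(1) tK] by auto
    moreover have "K \<subseteq> ball t (r t)" using pball tK by blast
    ultimately show ?thesis by (intro exI[of _ v] exI[of _ w]) auto
  qed
  define B where "B = {(t, K) \<in> p. t \<in> N}"
  have B: "B \<subseteq> p" "finite B" using fin unfolding B_def by (auto intro: finite_subset)
  \<comment> \<open>Intervals tagged in \<open>N\<close> lie inside \<open>U\<close>, so their total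
    length is below \<open>d\<close>.\<close>
  have bad: "(\<Sum>(t, K)\<in>B. norm (u (Sup K) - u (Inf K))) < e / 3"
  proof -
    have Bpart: "B tagged_partial_division_of {a..b}"
      using p(1) B(1) tagged_partial_division_subset unfolding tagged_division_of_def by blast
    have div: "snd ` B division_of \<Union> (snd ` B)"
      by (rule partial_division_of_tagged_division[OF Bpart])
    have sub: "\<Union> (snd ` B) \<subseteq> {a..b}"
      using tagged_partial_division_ofD(3)[OF Bpart] by fastforce
    have "(\<Sum>K\<in>snd ` B. Sup K - Inf K) = (\<Sum>K\<in>snd ` B. measure lebesgue K)"
    proof (rule sum.cong[OF refl])
      fix K assume "K \<in> snd ` B"
      then obtain t where "(t, K) \<in> p" using B(1) by auto
      from mem[OF this] show "Sup K - Inf K = measure lebesgue K" by auto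
    qed
    also have "\<dots> = measure lebesgue (\<Union> (snd ` B))"
      by (rule content_division[OF div])
    also have "\<dots> \<le> measure lebesgue U"
    proof (rule measure_mono_fmeasurable[OF _ _ U_meas])
      show "\<Union> (snd ` B) \<subseteq> U"
      proof clarsimp
        fix t K s assume "(t, K) \<in> B" "s \<in> K"
        then have "(t, K) \<in> p" "t \<in> N" unfolding B_def by auto
        with mem[OF this(1)] r(2)[of t] \<open>s \<in> K\<close> show "s \<in> U" by auto
      qed
      show "\<Union> (snd ` B) \<in> sets lebesgue"
        using lmeasurable_division[OF div] by (simp add: fmeasurableD)
    qed
    also have "\<dots> < d" by (rule U_small)
    finally have "(\<Sum>K\<in>snd ` B. norm (u (Sup K) - u (Inf K))) < e / 3"
      by (rule d[OF div sub])
    \<comment> \<open>Absolute continuity sums over a set of intervals, the Henstock sum over tagged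
      pairs. The two agree because an interval carrying two tags has empty interior and hence zero
      increment; the clause for \<open>{}\<close> makes the summand vanish on every box with empty
      interior.\<close>
    also have "(\<Sum>K\<in>snd ` B. norm (u (Sup K) - u (Inf K)))
        = (\<Sum>K\<in>snd ` B. if K = {} then 0 else norm (u (Sup K) - u (Inf K)))"
      using B(1) mem by (intro sum.cong) fastforce+
    also have "\<dots> = (\<Sum>(t, K)\<in>B. if K = {} then 0 else norm (u (Sup K) - u (Inf K)))"
    proof (rule sum.over_tagged_division_lemma[symmetric, OF tagged_partial_division_of_Union_self[OF Bpart]])
      fix v w :: real assume "box v w = {}"
      then show "(if cbox v w = {} then 0 else norm (u (Sup (cbox v w)) - u (Inf (cbox v w)))) = 0"
        by (cases "v = w") auto
    qed
    also have "\<dots> = (\<Sum>(t, K)\<in>B. norm (u (Sup K) - u (Inf K)))"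
      using B(1) mem by (intro sum.cong) fastforce+
    finally show ?thesis .
  qed
  \<comment> \<open>The tag lies between the endpoints, so the linearization errors at the two ends
    add up to at most \<open>c\<close> times the length.\<close>
  have good: "u (Sup K) - u (Inf K) \<le> measure lborel K *\<^sub>R g0 t + c * (Sup K - Inf K)"
    if "(t, K) \<in> p" "t \<notin> N" for t K
  proof -
    from mem[OF that(1)] obtain v w where K: "K = {v..w}" "v \<le> w" "t \<in> {v..w}" "t \<in> {a..b}"
      "{v..w} \<subseteq> ball t (r t)" by blast
    have "v \<in> {v..w}" "w \<in> {v..w}" using K(2) by auto
    then have "v \<in> ball t (r t)" "w \<in> ball t (r t)" using K(5) by blast+
    then have "\<bar>v - t\<bar> < r t" "\<bar>w - t\<bar> < r t" by (auto simp: dist_real_def)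
    with r(3)[of t] K(4) that(2)
    have "\<bar>u w - u t - u' t * (w - t)\<bar> \<le> c * \<bar>w - t\<bar>" "\<bar>u v - u t - u' t * (v - t)\<bar> \<le> c * \<bar>v - t\<bar>"
      by auto
    then have "u w - u t - u' t * (w - t) \<le> c * (w - t)" "- (u v - u t - u' t * (v - t)) \<le> c * (t - v)"
      using K(3) by auto
    then have "u w - u v \<le> u' t * (w - v) + c * (w - v)"
      by (simp add: algebra_simps)
    moreover have "u' t * (w - v) \<le> g t * (w - v)"
      using le[of t] K that(2) by (intro mult_right_mono) auto
    ultimately show ?thesis
      using K that(2) by (simp add: g0_def algebra_simps)
  qed
  have "u b - u a = (\<Sum>(t, K)\<in>p. u (Sup K) - u (Inf K))"
    using additive_tagged_division_1[OF \<open>a \<le> b\<close> p(1), of u] by simp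
  also have "\<dots> \<le> (\<Sum>(t, K)\<in>p. measure lborel K *\<^sub>R g0 t + c * (Sup K - Inf K)
      + (if t \<in> N then norm (u (Sup K) - u (Inf K)) else 0))"
  proof (rule sum_mono, clarify)
    fix t K assume tK: "(t, K) \<in> p"
    have "0 \<le> c * (Sup K - Inf K)" using mem[OF tK] \<open>c > 0\<close> by auto
    then show "u (Sup K) - u (Inf K) \<le> measure lborel K *\<^sub>R g0 t + c * (Sup K - Inf K)
      + (if t \<in> N then norm (u (Sup K) - u (Inf K)) else 0)"
      using good[OF tK] by (cases "t \<in> N") (auto simp: g0_def)
  qed
  also have "\<dots> = (\<Sum>(t, K)\<in>p. measure lborel K *\<^sub>R g0 t) + c * (\<Sum>(t, K)\<in>p. Sup K - Inf K)
      + (\<Sum>(t, K)\<in>B. norm (u (Sup K) - u (Inf K)))"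
  proof -
    have "(\<Sum>(t, K)\<in>p. if t \<in> N then norm (u (Sup K) - u (Inf K)) else 0)
        = (\<Sum>(t, K)\<in>B. norm (u (Sup K) - u (Inf K)))"
      by (rule sum.mono_neutral_cong_right[OF fin B(1)]) (auto simp: B_def split: if_splits)
    then show ?thesis
      by (simp add: split_def sum.distrib sum_distrib_left)
  qed
  also have "(\<Sum>(t, K)\<in>p. Sup K - Inf K) = b - a"
    using additive_tagged_division_1[OF \<open>a \<le> b\<close> p(1), of "\<lambda>t. t"] by simp
  also have "(\<Sum>(t, K)\<in>p. measure lborel K *\<^sub>R g0 t) + c * (b - a)
      + (\<Sum>(t, K)\<in>B. norm (u (Sup K) - u (Inf K))) \<le> I + e"
    using sum_g0[OF p(1) p\<gamma>0] bad c_le unfolding real_norm_def by linarith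
  finally show "u b - u a \<le> I + e" .
qed

section \<open>Decrease of the energy along the controller\<close>

lemma nonneg_orthant_closed_convex:
  "closed (nonneg_orthant :: (real^'m) set)" "convex (nonneg_orthant :: (real^'m) set)"
proof -
  have eq: "(nonneg_orthant :: (real^'m) set) = (\<Inter>i. {l. 0 \<le> l $ i})"
    by (auto simp: nonneg_orthant_def less_eq_vec_def)
  show "closed (nonneg_orthant :: (real^'m) set)"
    unfolding eq by (intro closed_INT ballI closed_Collect_le continuous_intros)
  show "convex (nonneg_orthant :: (real^'m) set)"
    unfolding convex_def nonneg_orthant_def by (auto simp: less_eq_vec_def)
qed

text \<open>\<open>A *v l\<close> combines the columns of \<open>A\<close> with weights
  \<open>l $ i\<close>. Nonnegative weights allow the subgradient inequalities to be added, so this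
  vector acts as a subgradient of the multiplier term of the Lagrangian.\<close>

lemma inner_matrix_vector_le_subgradient:
  fixes A :: "real^'m^'n"
  assumes sub: "\<And>i. is_subgradient X (\<lambda>y. G y $ i) x (column i A)"
    and l: "0 \<le> l" and z: "z \<in> X"
  shows "(z - x) \<bullet> (A *v l) \<le> l \<bullet> (G z - G x)"
proof -
  have "(z - x) \<bullet> (A *v l) = (\<Sum>i\<in>UNIV. l $ i * (column i A \<bullet> (z - x)))"
    by (simp add: matrix_mult_sum inner_sum_right scalar_mult_eq_scaleR inner_commute)
  also have "\<dots> \<le> (\<Sum>i\<in>UNIV. l $ i * (G z $ i - G x $ i))"
  proof (intro sum_mono mult_left_mono)
    fix i
    show "column i A \<bullet> (z - x) \<le> G z $ i - G x $ i"
      using sub[of i] z unfolding is_subgradient_def by force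
    show "0 \<le> l $ i" using l by (simp add: less_eq_vec_def)
  qed
  also have "\<dots> = l \<bullet> (G z - G x)"
    by (simp add: inner_vec_def)
  finally show ?thesis .
qed

text \<open>The left side is the derivative of the energy along the controller. After
  \<open>projected_field_inner_le\<close> removes both projections, convexity bounds the primal
  part, the dual part is linear in the multiplier, and the two occurrences of
  \<open>l \<bullet> G x\<close> cancel.\<close>

lemma saddle_point_energy_rate:
  fixes A :: "real^'m^'n"
  assumes X: "closed X" "convex X" and x: "x \<in> X" "xb \<in> X"
    and l: "l \<in> nonneg_orthant" "lb \<in> nonneg_orthant" and "\<epsilon> > 0"
    and p: "is_subgradient X F x p"
    and A: "\<And>i. is_subgradient X (\<lambda>y. G y $ i) x (column i A)"
  shows "(x - xb) \<bullet> projected_field X x (- (\<epsilon> *\<^sub>R (p + A *v l)))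
      + (l - lb) \<bullet> projected_field nonneg_orthant l (\<epsilon> *\<^sub>R G x)
    \<le> \<epsilon> * (F xb - F x + l \<bullet> G xb - lb \<bullet> G x)" (is "?x + ?l \<le> _")
proof -
  have "?x \<le> (x - xb) \<bullet> (- (\<epsilon> *\<^sub>R (p + A *v l)))"
    using X x by (intro projected_field_inner_le)
  also have "\<dots> = \<epsilon> * (p \<bullet> (xb - x) + (xb - x) \<bullet> (A *v l))"
    by (simp add: inner_simps inner_commute algebra_simps)
  also have "\<dots> \<le> \<epsilon> * (F xb - F x + l \<bullet> (G xb - G x))"
  proof (intro mult_left_mono add_mono)
    show "p \<bullet> (xb - x) \<le> F xb - F x"
      using p x(2) unfolding is_subgradient_def by force
    show "(xb - x) \<bullet> (A *v l) \<le> l \<bullet> (G xb - G x)"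
      using A l(1) x(2) by (intro inner_matrix_vector_le_subgradient) (auto simp: nonneg_orthant_def)
  qed (use \<open>\<epsilon> > 0\<close> in simp)
  finally have 1: "?x \<le> \<epsilon> * (F xb - F x + l \<bullet> (G xb - G x))" .
  have "?l \<le> (l - lb) \<bullet> (\<epsilon> *\<^sub>R G x)"
    using nonneg_orthant_closed_convex l by (intro projected_field_inner_le)
  with 1 show ?thesis
    by (simp add: inner_simps algebra_simps)
qed

lemma energy_has_real_derivative:
  assumes "(x has_vector_derivative x') (at t)" "(l has_vector_derivative l') (at t)"
  shows "((\<lambda>s. energy xb lb (x s) (l s)) has_real_derivative (x t - xb) \<bullet> x' + (l t - lb) \<bullet> l') (at t)"
proof -
  note [derivative_intros] = assms[unfolded has_vector_derivative_def]
  show ?thesis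
    unfolding energy_def power2_norm_eq_inner has_field_derivative_def
    by (rule derivative_eq_intros refl)+ (auto simp: fun_eq_iff inner_simps inner_commute algebra_simps)
qed

text \<open>Integrated form of the energy rate. The term \<open>l t \<bullet> g t xb\<close> is
  nonpositive by feasibility of \<open>xb\<close>, and the final energy is nonnegative, so both are
  dropped. Since \<open>lb\<close> is constant in time it leaves the integral, and it may be chosen
  after the trajectory is known.\<close>

lemma saddle_point_energy_decrease:
  fixes X :: "(real^'n) set" and g :: "real \<Rightarrow> real^'n \<Rightarrow> real^'m"
  assumes X: "closed X" "convex X" and "\<epsilon> > 0" and "T > 0"
    and f0x: "\<And>t y. y \<in> X \<Longrightarrow> is_subgradient X (f0 t) y (f0x t y)"
    and gx: "\<And>t y i. y \<in> X \<Longrightarrow> is_subgradient X (\<lambda>y. g t y $ i) y (column i (gx t y))"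
    and traj: "saddle_point_trajectory X f0x g gx \<epsilon> x l"
    and xb: "xb \<in> X" "\<And>t. t \<in> {0..T} \<Longrightarrow> g t xb \<le> 0" and lb: "lb \<in> nonneg_orthant"
    and int: "(\<lambda>t. f0 t xb) integrable_on {0..T}" "(\<lambda>t. f0 t (x t)) integrable_on {0..T}"
      "(\<lambda>t. g t (x t)) integrable_on {0..T}"
  shows "integral {0..T} (\<lambda>t. f0 t (x t)) - integral {0..T} (\<lambda>t. f0 t xb)
      + lb \<bullet> integral {0..T} (\<lambda>t. g t (x t)) \<le> 1/\<epsilon> * energy xb lb (x 0) (l 0)"
proof -
  have feas: "x t \<in> X" "l t \<in> nonneg_orthant" if "t \<ge> 0" for t
    using traj that unfolding saddle_point_trajectory_def by auto
  let ?x' = "\<lambda>t. projected_field X (x t) (- (\<epsilon> *\<^sub>R (f0x t (x t) + gx t (x t) *v l t)))"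
  let ?l' = "\<lambda>t. projected_field nonneg_orthant (l t) (\<epsilon> *\<^sub>R g t (x t))"
  let ?V = "\<lambda>t. energy xb lb (x t) (l t)"
  let ?g = "\<lambda>t. \<epsilon> * (f0 t xb - f0 t (x t) - lb \<bullet> g t (x t))"
  have "AE t in lebesgue. t > 0 \<longrightarrow>
      (x has_vector_derivative ?x' t) (at t) \<and> (l has_vector_derivative ?l' t) (at t)"
    using traj unfolding saddle_point_trajectory_def by auto
  then obtain N where N: "N \<in> null_sets lebesgue" and N_sub:
    "{t \<in> space lebesgue. \<not> (t > 0 \<longrightarrow>
      (x has_vector_derivative ?x' t) (at t) \<and> (l has_vector_derivative ?l' t) (at t))} \<subseteq> N"
    unfolding eventually_ae_filter by blast
  have der: "(x has_vector_derivative ?x' t) (at t)" "(l has_vector_derivative ?l' t) (at t)"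
    if "t > 0" "t \<notin> N" for t
    using N_sub that by auto
  have "?V T - ?V 0 \<le> \<epsilon> * (integral {0..T} (\<lambda>t. f0 t xb) - integral {0..T} (\<lambda>t. f0 t (x t))
      - lb \<bullet> integral {0..T} (\<lambda>t. g t (x t)))"
  proof (rule abs_cont_on_increment_le_integral[where u = ?V and g = ?g and N = "insert 0 N" and
        u' = "\<lambda>t. (x t - xb) \<bullet> ?x' t + (l t - lb) \<bullet> ?l' t"])
    have "abs_cont_on 0 T x" "abs_cont_on 0 T l"
      using traj \<open>T > 0\<close> unfolding saddle_point_trajectory_def by auto
    then have "abs_cont_on 0 T (\<lambda>t. (norm (x t - xb))\<^sup>2 / 2 + (norm (l t - lb))\<^sup>2 / 2)"
      by (intro abs_cont_on_add abs_cont_on_half_norm_squared)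
    then show "abs_cont_on 0 T ?V"
      by (simp add: energy_def add_divide_distrib)
    \<comment> \<open>Time 0 joins the exceptional set because the differential equations are
      imposed only at positive times.\<close>
    show "negligible (insert 0 N)"
      using N by (simp add: negligible_iff_null_sets)
    show "(?V has_real_derivative (x t - xb) \<bullet> ?x' t + (l t - lb) \<bullet> ?l' t) (at t)"
      if "t \<in> {0..T} - insert 0 N" for t
      using that by (intro energy_has_real_derivative der) auto
    show "(x t - xb) \<bullet> ?x' t + (l t - lb) \<bullet> ?l' t \<le> ?g t" if t: "t \<in> {0..T} - insert 0 N" for t
    proof -
      have "(x t - xb) \<bullet> ?x' t + (l t - lb) \<bullet> ?l' t
          \<le> \<epsilon> * (f0 t xb - f0 t (x t) + l t \<bullet> g t xb - lb \<bullet> g t (x t))"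
        using t feas[of t] \<open>\<epsilon> > 0\<close>
        by (intro saddle_point_energy_rate X xb(1) lb f0x gx) auto
      also have "\<dots> \<le> ?g t"
      proof -
        have "0 \<le> l t" using feas[of t] t by (auto simp: nonneg_orthant_def)
        then have "l t \<bullet> g t xb \<le> 0"
          using xb(2)[of t] t unfolding inner_vec_def
          by (intro sum_nonpos) (auto simp: less_eq_vec_def mult_nonneg_nonpos)
        then show ?thesis using \<open>\<epsilon> > 0\<close> by (intro mult_left_mono) auto
      qed
      finally show ?thesis .
    qed
    show "(?g has_integral \<epsilon> * (integral {0..T} (\<lambda>t. f0 t xb) - integral {0..T} (\<lambda>t. f0 t (x t))
      - lb \<bullet> integral {0..T} (\<lambda>t. g t (x t)))) {0..T}"
      using has_integral_linear[OF integrable_integral[OF int(3)] bounded_linear_inner_right[of lb]]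
      by (intro has_integral_mult_right has_integral_diff integrable_integral int) (simp add: o_def)
  qed (use \<open>T > 0\<close> in simp)
  moreover have "?V T \<ge> 0" by (simp add: energy_def)
  ultimately have "\<epsilon> * (integral {0..T} (\<lambda>t. f0 t (x t)) - integral {0..T} (\<lambda>t. f0 t xb)
      + lb \<bullet> integral {0..T} (\<lambda>t. g t (x t))) \<le> ?V 0"
    by (simp add: algebra_simps)
  then show ?thesis
    using \<open>\<epsilon> > 0\<close> by (simp add: field_simps)
qed

section \<open>Bounds on the regret and the saturated fit\<close>

text \<open>The affine minorant given by one subgradient is bounded below on a bounded set. Hence
  the infimum of \<open>f0 t\<close> over \<open>X\<close> in the hypothesis on \<open>K\<close> is
  a genuine lower bound.\<close>

lemma bdd_below_of_subgradient:
  assumes "bounded X" "x \<in> X" "is_subgradient X F x v"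
  shows "bdd_below (F ` X)"
proof -
  obtain D where D: "\<And>y. y \<in> X \<Longrightarrow> norm y \<le> D"
    using assms(1) by (auto simp: bounded_iff)
  have "F x - norm v * (D + norm x) \<le> F y" if "y \<in> X" for y
  proof -
    have "- (v \<bullet> (y - x)) \<le> norm v * norm (y - x)"
      using Cauchy_Schwarz_ineq2[of v "y - x"] by linarith
    also have "\<dots> \<le> norm v * (D + norm x)"
      using D[OF that] norm_triangle_ineq4[of y x] by (intro mult_left_mono) auto
    finally show ?thesis
      using assms(3) that unfolding is_subgradient_def by force
  qed
  then show ?thesis by (intro bdd_belowI2)
qed

text \<open>The cross term of the expanded square has a favourable sign. The coefficient 1/2 of
  \<open>c\<^sup>2\<close> is what matters: it is smaller than the coefficient 1 that the fit term
  produces on the other side.\<close>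

lemma energy_axis_le:
  assumes "l \<in> nonneg_orthant" "c \<ge> 0"
  shows "energy xb (axis i c) x l \<le> 1/2 * ((norm (x - xb))\<^sup>2 + (norm l)\<^sup>2 + c\<^sup>2)"
proof -
  have "(norm (l - axis i c))\<^sup>2 = (norm l)\<^sup>2 + c\<^sup>2 - 2 * (l $ i * c)"
    unfolding power2_norm_eq_inner
    by (simp add: inner_simps inner_axis inner_axis_axis inner_commute power2_eq_square)
  moreover have "l $ i * c \<ge> 0"
    using assms by (simp add: nonneg_orthant_def less_eq_vec_def)
  ultimately show ?thesis by (simp add: energy_def)
qed

theorem corollary3:
  fixes X :: "(real^'n) set"
    and f :: "real \<Rightarrow> real^'n \<Rightarrow> real^'m"
    and f0 :: "real \<Rightarrow> real^'n \<Rightarrow> real"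
    and \<delta> :: real
    and x0 :: "real^'n"
    and l0 :: "real^'m"
  assumes "compact X" and "convex X"
    and "\<And>T x. T > 0 \<Longrightarrow> x \<in> X \<Longrightarrow> (\<lambda>t. f t x) absolutely_integrable_on {0..T}"
    and "\<And>T x. T > 0 \<Longrightarrow> x \<in> X \<Longrightarrow> (\<lambda>t. f0 t x) absolutely_integrable_on {0..T}"
    and "\<And>t. convex_on X (f0 t)"
    and "\<And>t i. convex_on X (\<lambda>x. f t x $ i)"
    and "\<exists>xd\<in>X. \<forall>t\<ge>0. f t xd \<le> 0"
    and "\<delta> > 0"
    and "\<And>t. subdifferentiable_on X (f0 t)"
    and "\<And>t i. subdifferentiable_on X (\<lambda>x. f t x $ i)"
    and "\<And>t i. subdifferentiable_on X (\<lambda>x. saturate \<delta> f t x $ i)"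
    and "x0 \<in> X" and "l0 \<in> nonneg_orthant"
  shows "\<exists>C::real.
    \<forall>(f0x :: real \<Rightarrow> real^'n \<Rightarrow> real^'n) (fbx :: real \<Rightarrow> real^'n \<Rightarrow> real^'m^'n)
      (xs :: real \<Rightarrow> real^'n) (K :: real).
      (\<forall>t. \<forall>x\<in>X. is_subgradient X (f0 t) x (f0x t x)) \<longrightarrow>
      (\<forall>t. \<forall>x\<in>X. \<forall>i. is_subgradient X (\<lambda>y. saturate \<delta> f t y $ i) x (column i (fbx t x))) \<longrightarrow>
      (\<forall>T>0. offline_optimal X f f0 T (xs T)) \<longrightarrow>
      (\<forall>T>0. \<forall>t\<in>{0..T}. K \<ge> f0 t (xs T) - (INF y\<in>X. f0 t y)) \<longrightarrow>
      (\<forall>\<epsilon>>1. \<forall>x l.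
         saddle_point_trajectory X f0x (saturate \<delta> f) fbx \<epsilon> x l \<longrightarrow>
         x 0 = x0 \<longrightarrow> l 0 = l0 \<longrightarrow>
         (\<forall>T>0. (\<lambda>t. f0 t (x t)) absolutely_integrable_on {0..T} \<and>
                (\<lambda>t. saturate \<delta> f t (x t)) absolutely_integrable_on {0..T}) \<longrightarrow>
         (\<forall>T>0. regret f0 T x (xs T) \<le> 1/\<epsilon> * energy (xs T) 0 x0 l0 \<and>
                (\<forall>i. saturated_fit \<delta> f T x $ i \<le> C * (1 + sqrt (K * T)))))"
proof -
  from \<open>compact X\<close> obtain D where D: "\<And>y. y \<in> X \<Longrightarrow> norm (x0 - y) \<le> D" and "D \<ge> 0"
    using bounded_any_center[of X x0] compact_imp_bounded[of X] assms(12)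
    by (metis dist_norm dist_self)
  \<comment> \<open>\<open>C\<close> involves only the initial values and the extent of
    \<open>X\<close> around \<open>x0\<close>. The summand 2 gives \<open>C\<^sup>2 \<ge> 4\<close>,
    which later absorbs the factor in \<open>2 * (K * T)\<close>.\<close>
  define C where "C = 2 + D + norm l0"
  show ?thesis
  proof (intro exI[of _ C] allI impI conjI)
    fix f0x :: "real \<Rightarrow> real^'n \<Rightarrow> real^'n" and fbx :: "real \<Rightarrow> real^'n \<Rightarrow> real^'m^'n"
      and xs :: "real \<Rightarrow> real^'n" and K \<epsilon> T :: real and x l i
    assume f0x: "\<forall>t. \<forall>x\<in>X. is_subgradient X (f0 t) x (f0x t x)"
      and fbx: "\<forall>t. \<forall>x\<in>X. \<forall>i. is_subgradient X (\<lambda>y. saturate \<delta> f t y $ i) x (column i (fbx t x))"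
      and opt: "\<forall>T>0. offline_optimal X f f0 T (xs T)"
      and K: "\<forall>T>0. \<forall>t\<in>{0..T}. K \<ge> f0 t (xs T) - (INF y\<in>X. f0 t y)"
      and "\<epsilon> > 1" and traj: "saddle_point_trajectory X f0x (saturate \<delta> f) fbx \<epsilon> x l"
      and init: "x 0 = x0" "l 0 = l0"
      and int: "\<forall>T>0. (\<lambda>t. f0 t (x t)) absolutely_integrable_on {0..T} \<and>
                (\<lambda>t. saturate \<delta> f t (x t)) absolutely_integrable_on {0..T}"
      and "T > 0"
    have xs: "xs T \<in> X" "\<And>t. t \<in> {0..T} \<Longrightarrow> f t (xs T) \<le> 0"
      using opt \<open>T > 0\<close> unfolding offline_optimal_def is_arg_min_def by auto
    \<comment> \<open>The cut level \<open>- \<delta>\<close> is itself negative, so saturation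
      preserves feasibility.\<close>
    have sat: "saturate \<delta> f t (xs T) \<le> 0" if "t \<in> {0..T}" for t
      using xs(2)[OF that] \<open>\<delta> > 0\<close> by (simp add: saturate_def less_eq_vec_def)
    have int': "(\<lambda>t. f0 t (xs T)) integrable_on {0..T}" "(\<lambda>t. f0 t (x t)) integrable_on {0..T}"
      "(\<lambda>t. saturate \<delta> f t (x t)) integrable_on {0..T}"
      using assms(4)[OF \<open>T > 0\<close> xs(1)] int \<open>T > 0\<close> by (auto simp: absolutely_integrable_on_def)
    have gap: "regret f0 T x (xs T) + lb \<bullet> saturated_fit \<delta> f T x \<le> 1/\<epsilon> * energy (xs T) lb x0 l0"
      if "lb \<in> nonneg_orthant" for lb
      using saddle_point_energy_decrease[OF compact_imp_closed[OF \<open>compact X\<close>] \<open>convex X\<close> _ \<open>T > 0\<close> _ _ traj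
          xs(1) sat that int'] f0x fbx \<open>\<epsilon> > 1\<close> init
      by (simp add: regret_def saturated_fit_def)
    show "regret f0 T x (xs T) \<le> 1/\<epsilon> * energy (xs T) 0 x0 l0"
      using gap[of 0] by (simp add: nonneg_orthant_def)
    have Inf_le: "(INF y\<in>X. f0 t y) \<le> f0 t y" if "y \<in> X" for t y
      by (intro cINF_lower that bdd_below_of_subgradient[OF compact_imp_bounded[OF \<open>compact X\<close>] that])
        (use f0x that in blast)
    have "f0 0 (xs T) - (INF y\<in>X. f0 0 y) \<le> K" using K \<open>T > 0\<close> by auto
    with Inf_le[OF xs(1), of 0] have "K \<ge> 0" by linarith
    \<comment> \<open>At each time the trajectory pays at least the infimum over \<open>X\<close>,
      which is at most \<open>K\<close> below the cost of \<open>xs T\<close>; this is integrated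
      over the horizon.\<close>
    have lower: "- (K * T) \<le> regret f0 T x (xs T)"
    proof -
      have "integral {0..T} (\<lambda>t. f0 t (xs T) - K) \<le> integral {0..T} (\<lambda>t. f0 t (x t))"
      proof (intro integral_le integrable_diff int' integrable_const_ivl)
        fix t assume t: "t \<in> {0..T}"
        then have "x t \<in> X" using traj unfolding saddle_point_trajectory_def by auto
        moreover have "f0 t (xs T) - (INF y\<in>X. f0 t y) \<le> K" using K \<open>T > 0\<close> t by blast
        ultimately show "f0 t (xs T) - K \<le> f0 t (x t)" using Inf_le[of "x t" t] by linarith
      qed
      also have "integral {0..T} (\<lambda>t. f0 t (xs T) - K) = integral {0..T} (\<lambda>t. f0 t (xs T)) - K * T"
        using \<open>T > 0\<close> by (simp add: integral_diff int' integrable_const_ivl)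
      finally show ?thesis by (simp add: regret_def)
    qed
    let ?F = "saturated_fit \<delta> f T x $ i"
    have "C > 0" using \<open>D \<ge> 0\<close> norm_ge_zero[of l0] unfolding C_def by linarith
    show "?F \<le> C * (1 + sqrt (K * T))"
    proof (cases "?F \<le> 0")
      case True
      then show ?thesis
        using \<open>C > 0\<close> \<open>K \<ge> 0\<close> \<open>T > 0\<close> by (smt (verit) mult_nonneg_nonneg real_sqrt_ge_zero)
    next
      case False
      \<comment> \<open>The multiplier depends on the fit itself, so that its inner product with the
        fit is \<open>?F\<^sup>2\<close>; positivity of \<open>?F\<close> makes it
        admissible.\<close>
      then have "axis i ?F \<in> nonneg_orthant"
        by (auto simp: nonneg_orthant_def less_eq_vec_def axis_def)
      from gap[OF this] have "?F\<^sup>2 - K * T \<le> 1/\<epsilon> * energy (xs T) (axis i ?F) x0 l0"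
        using lower by (simp add: inner_axis' power2_eq_square)
      \<comment> \<open>Here the gain disappears: \<open>1/\<epsilon>\<close> is below 1, which
        makes the bound uniform in \<open>\<epsilon>\<close>.\<close>
      also have "\<dots> \<le> 1 * energy (xs T) (axis i ?F) x0 l0"
        using \<open>\<epsilon> > 1\<close> by (intro mult_right_mono) (auto simp: energy_def)
      also have "\<dots> \<le> 1/2 * ((norm (x0 - xs T))\<^sup>2 + (norm l0)\<^sup>2 + ?F\<^sup>2)"
        using energy_axis_le[OF assms(13), of ?F] False by simp
      \<comment> \<open>Half of \<open>?F\<^sup>2\<close> is absorbed on the left and the inequality
        is doubled.\<close>
      finally have "?F\<^sup>2 \<le> 2 * (K * T) + (norm (x0 - xs T))\<^sup>2 + (norm l0)\<^sup>2"
        by simp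
      also have "(norm (x0 - xs T))\<^sup>2 \<le> D\<^sup>2"
        using D[OF xs(1)] by (intro power_mono) auto
      finally have "?F\<^sup>2 \<le> 2 * (K * T) + D\<^sup>2 + (norm l0)\<^sup>2" by simp
      also have "\<dots> \<le> C\<^sup>2 + C\<^sup>2 * (K * T)"
      proof -
        have "4 + D\<^sup>2 + (norm l0)\<^sup>2 \<le> C\<^sup>2"
          using \<open>D \<ge> 0\<close> by (simp add: C_def power2_eq_square algebra_simps)
        moreover from this have "2 * (K * T) \<le> C\<^sup>2 * (K * T)"
          using \<open>K \<ge> 0\<close> \<open>T > 0\<close> zero_le_power2[of D] zero_le_power2[of "norm l0"]
          by (intro mult_right_mono) (linarith, simp)
        ultimately show ?thesis by linarith
      qed
      \<comment> \<open>Expanding the square leaves the nonnegative surplus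
        \<open>2 * C\<^sup>2 * sqrt (K * T)\<close>.\<close>
      also have "\<dots> \<le> (C * (1 + sqrt (K * T)))\<^sup>2"
      proof -
        have "(C * (1 + sqrt (K * T)))\<^sup>2 = C\<^sup>2 * (1 + K * T) + 2 * C\<^sup>2 * sqrt (K * T)"
          using \<open>K \<ge> 0\<close> \<open>T > 0\<close> by (simp add: power_mult_distrib power2_sum) (simp add: algebra_simps)
        then show ?thesis using \<open>K \<ge> 0\<close> \<open>T > 0\<close> by (simp add: algebra_simps)
      qed
      finally show ?thesis
        by (rule power2_le_imp_le) (use \<open>C > 0\<close> \<open>K \<ge> 0\<close> \<open>T > 0\<close> in simp)
    qed
  qed
qed

end
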